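(* Let $s,N\in\mathbb{N}$ and $\boldsymbol{z}\in\{1,\ldots,N-1\}^s$. Let $\alpha,\alpha'>1/2$ be real and let $\boldsymbol{\gamma}=(\gamma_u)_u$, $\boldsymbol{\gamma}'=(\gamma'_u)_u$ be families of non-negative real weights such that $\gamma_v\ge\gamma_u$ whenever $v\subset u$. Then $$P_{\alpha',\boldsymbol{\gamma}',N}(\boldsymbol{z})\le c_{\alpha'}\,\bigl(\rho_{\alpha,\boldsymbol{\gamma},N}(\boldsymbol{z})\bigr)^{\alpha'/\alpha}\sum_{\emptyset\ne u\subseteq\{1,\ldots,s\}}\frac{\gamma'_u}{\gamma_u^{\alpha'/\alpha}}\left(\frac{2^{2\alpha'+1}}{2^{2\alpha'-1}-1}\right)^{|u|}(\log_2 N)^{|u|-1},$$ where $$c_{\alpha'}=(1+\zeta(2\alpha'))+(2^{2\alpha'}+\zeta(2\alpha'))\,\frac{2^{2\alpha'-1}-1}{2^{4\alpha'}}$$ and $\zeta$ is the Riemann zeta function.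
   Context: $\mathbb{N}$ is the set of positive integers. Weights are families $\boldsymbol{\gamma}=(\gamma_u)$ of non-negative reals indexed by the finite non-empty subsets $u\subset\mathbb{N}$. For $\boldsymbol{z}\in\{1,\ldots,N-1\}^s$ (so $N\ge2$) and non-empty $u\subseteq\{1,\ldots,s\}$ let $$P_u^\perp(\boldsymbol{z})=\Bigl\{\boldsymbol{k}_u=(k_j)_{j\in u}\in(\mathbb{Z}\setminus\{0\})^{|u|} : \sum_{j\in u}k_jz_j\equiv0 \pmod N\Bigr\}.$$ For $\boldsymbol{k}_u\in(\mathbb{Z}\setminus\{0\})^{|u|}$ let $r_\alpha(\boldsymbol{\gamma},\boldsymbol{k}_u)=\gamma_u\prod_{j\in u}|k_j|^{-2\alpha}$. Define $$P_{\alpha,\boldsymbol{\gamma},N}(\boldsymbol{z})=\sum_{\emptyset\ne u\subseteq\{1,\ldots,s\}}\ \sum_{\boldsymbol{k}_u\in P_u^\perp(\boldsymbol{z})}r_\alpha(\boldsymbol{\gamma},\boldsymbol{k}_u),\qquad \rho_{\alpha,\boldsymbol{\gamma},N}(\boldsymbol{z})=\max_{\emptyset\ne u\subseteq\{1,\ldots,s\}}\ \max_{\boldsymbol{k}_u\in P_u^\perp(\boldsymbol{z})}r_\alpha(\boldsymbol{\gamma},\boldsymbol{k}_u).$$ ($P_{\alpha,\boldsymbol{\gamma},N}(\boldsymbol{z})$ is the squared worst-case error, in the weighted Korobov space with smoothness $\alpha$ and weights $\boldsymbol{\gamma}$, of the lattice rule $f\mapsto\frac1N\sum_{n=0}^{N-1}f(\{n\boldsymbol{z}/N\})$.)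 Convention: $0/0=0$; if $\gamma_u=0<\gamma'_u$ for some non-empty $u\subseteq\{1,\ldots,s\}$, the right-hand side is read as $+\infty$. *)

theory Defs
  imports "HOL-Analysis.Analysis" "HOL-Number_Theory.Cong"
begin

(* The index set of a family of weights: weights are functions nat set \<Rightarrow> real of which
   only the values on this set are relevant. *)
definition fin_nonempty_sets :: "nat set set" where
  "fin_nonempty_sets = {u. finite u \<and> u \<noteq> {} \<and> (\<forall>j\<in>u. 1 \<le> j)}"

definition coord_sets :: "nat \<Rightarrow> nat set set" where
  "coord_sets s = {u. u \<subseteq> {1..s} \<and> u \<noteq> {}}"

(* A vector indexed by u is a function that is undefined outside u, so distinct members of
   this set are distinct vectors. *)
definition dual_lattice :: "nat \<Rightarrow> (nat \<Rightarrow> nat) \<Rightarrow> nat set \<Rightarrow> (nat \<Rightarrow> int) set" where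
  "dual_lattice N z u =
     {k \<in> u \<rightarrow>\<^sub>E (UNIV - {0}). [(\<Sum>j\<in>u. k j * int (z j)) = 0] (mod int N)}"

definition r_weight :: "real \<Rightarrow> (nat set \<Rightarrow> real) \<Rightarrow> nat set \<Rightarrow> (nat \<Rightarrow> int) \<Rightarrow> real" where
  "r_weight \<alpha> \<gamma> u k = \<gamma> u * (\<Prod>j\<in>u. real_of_int \<bar>k j\<bar> powr (- 2 * \<alpha>))"

(* Taken in ennreal, where the infinite sum of non-negative terms is always meaningful
   (over the reals, infsum of a divergent family would be 0). *)
definition P_err ::
    "real \<Rightarrow> (nat set \<Rightarrow> real) \<Rightarrow> nat \<Rightarrow> nat \<Rightarrow> (nat \<Rightarrow> nat) \<Rightarrow> ennreal" where
  "P_err \<alpha> \<gamma> N s z =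
     (\<Sum>u\<in>coord_sets s. \<Sum>\<^sub>\<infinity>k\<in>dual_lattice N z u. ennreal (r_weight \<alpha> \<gamma> u k))"

(* The inner maximum ranges over an infinite set, for which Max is unspecified; the supremum
   is attained by r_weight_Sup_attained below, so it is the maximum. *)
definition rho :: "real \<Rightarrow> (nat set \<Rightarrow> real) \<Rightarrow> nat \<Rightarrow> nat \<Rightarrow> (nat \<Rightarrow> nat) \<Rightarrow> real" where
  "rho \<alpha> \<gamma> N s z =
     Max ((\<lambda>u. SUP k\<in>dual_lattice N z u. r_weight \<alpha> \<gamma> u k) ` coord_sets s)"

(* The Dirichlet series; equal to the Riemann zeta function at real arguments x > 1. *)
definition zeta :: "real \<Rightarrow> real" where
  "zeta x = (\<Sum>n. 1 / real (Suc n) powr x)"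

definition c_const :: "real \<Rightarrow> real" where
  "c_const a = (1 + zeta (2 * a)) +
     (2 powr (2 * a) + zeta (2 * a)) * ((2 powr (2 * a - 1) - 1) / 2 powr (4 * a))"

lemma dual_lattice_nonempty:
  assumes "N \<ge> 1"
  shows "dual_lattice N z u \<noteq> {}"
proof -
  have "(\<lambda>j\<in>u. int N) \<in> dual_lattice N z u"
    using assms by (auto simp: dual_lattice_def cong_0_iff intro!: dvd_sum)
  then show ?thesis by blast
qed

lemma r_weight_Sup_attained:
  assumes u: "finite u" and N: "N \<ge> 1" and a: "\<alpha> > 0" and g: "\<gamma> u \<ge> 0"
  shows "\<exists>k\<in>dual_lattice N z u. (\<forall>l\<in>dual_lattice N z u. r_weight \<alpha> \<gamma> u l \<le> r_weight \<alpha> \<gamma> u k)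
           \<and> (SUP l\<in>dual_lattice N z u. r_weight \<alpha> \<gamma> u l) = r_weight \<alpha> \<gamma> u k"
proof -
  let ?D = "dual_lattice N z u"
  let ?r = "r_weight \<alpha> \<gamma> u"
  let ?p = "\<lambda>k. \<Prod>j\<in>u. real_of_int \<bar>k j\<bar> powr (- 2 * \<alpha>)"
  obtain k0 where k0: "k0 \<in> ?D" using dual_lattice_nonempty[OF N] by blast
  have nz: "real_of_int \<bar>k j\<bar> \<ge> 1" if "k \<in> ?D" "j \<in> u" for k j
  proof -
    have "k j \<noteq> 0" using that by (auto simp: dual_lattice_def PiE_def Pi_def)
    then have "\<bar>k j\<bar> \<ge> 1" by linarith
    then show ?thesis by linarith
  qed
  have p0: "?p k0 > 0"
    using nz[OF k0] by (intro prod_pos) fastforce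
  define B where "B = ?p k0 powr (- 1 / (2 * \<alpha>))"
  let ?S = "{k \<in> ?D. ?p k \<ge> ?p k0}"
  have bound: "real_of_int \<bar>k j\<bar> \<le> B" if k: "k \<in> ?D" "?p k \<ge> ?p k0" and j: "j \<in> u" for k j
  proof -
    have le1: "real_of_int \<bar>k i\<bar> powr (- 2 * \<alpha>) \<le> 1" if "i \<in> u" for i
      using powr_mono[of "- 2 * \<alpha>" 0 "real_of_int \<bar>k i\<bar>"] nz[OF k(1) that] a by (simp split: if_splits)
    have "?p k = real_of_int \<bar>k j\<bar> powr (- 2 * \<alpha>)
             * (\<Prod>i\<in>u - {j}. real_of_int \<bar>k i\<bar> powr (- 2 * \<alpha>))"
      using u j by (simp add: prod.remove)
    also have "\<dots> \<le> real_of_int \<bar>k j\<bar> powr (- 2 * \<alpha>) * 1"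
      by (intro mult_left_mono prod_le_1) (use le1 in auto)
    finally have "?p k0 \<le> real_of_int \<bar>k j\<bar> powr (- 2 * \<alpha>)"
      using k(2) by simp
    then have "(real_of_int \<bar>k j\<bar> powr (- 2 * \<alpha>)) powr (- 1 / (2 * \<alpha>)) \<le> B"
      unfolding B_def using p0 a by (intro powr_mono2') auto
    moreover have "(real_of_int \<bar>k j\<bar> powr (- 2 * \<alpha>)) powr (- 1 / (2 * \<alpha>)) = real_of_int \<bar>k j\<bar>"
      using a nz[OF k(1) j] by (simp add: powr_powr)
    ultimately show ?thesis by simp
  qed
  have "?S \<subseteq> u \<rightarrow>\<^sub>E {- \<lfloor>B\<rfloor>..\<lfloor>B\<rfloor>}"
  proof
    fix k assume k: "k \<in> ?S"
    have "k j \<in> {- \<lfloor>B\<rfloor>..\<lfloor>B\<rfloor>}" if "j \<in> u" for j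
    proof -
      have "\<bar>k j\<bar> \<le> \<lfloor>B\<rfloor>" using bound[of k j] k that by (simp add: le_floor_iff)
      then show ?thesis by auto
    qed
    moreover have "k \<in> extensional u" using k by (auto simp: dual_lattice_def PiE_def)
    ultimately show "k \<in> u \<rightarrow>\<^sub>E {- \<lfloor>B\<rfloor>..\<lfloor>B\<rfloor>}" by (auto simp: PiE_def)
  qed
  then have fin: "finite ?S"
    using u by (meson finite_PiE finite_atLeastAtMost_int finite_subset)
  have "k0 \<in> ?S" using k0 by simp
  then have "Max (?p ` ?S) \<in> ?p ` ?S" using fin by (intro Max_in) auto
  then obtain k where k: "k \<in> ?S" "?p k = Max (?p ` ?S)" by auto
  have top: "?p l \<le> ?p k" if "l \<in> ?D" for l
  proof (cases "?p l \<ge> ?p k0")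
    case True
    then show ?thesis using k(2) fin that by (auto intro!: Max_ge)
  next
    case False
    then show ?thesis using k(1) by auto
  qed
  have max: "\<forall>l\<in>?D. ?r l \<le> ?r k"
    using top g by (auto simp: r_weight_def intro!: mult_left_mono)
  have "(SUP l\<in>?D. ?r l) = ?r k"
    using k(1) max by (intro cSup_eq_maximum) auto
  then show ?thesis using k(1) max by blast
qed

end

(*
Fix u with |u| = d and let r = max 1 ((gamma_u / rho)^(1 / (2 alpha))). By monotonicity of the
weights every point k of the dual lattice on u, and every difference of two such points, has
product of max(1, |k_j|) at least r. Fix one coordinate i and sort the points by their signs and by
the dyadic sizes 2^(m_j) of the other d - 1 coordinates; let |m| be the sum of the m_j and let t be
the integer part of log_2 r. If |m| <= t, then the values |k_i| in a class are r / 2^|m| apart, so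
the class contributes at most r^(-2 alpha') (1 + zeta(2 alpha')). If |m| > t, split the class into
2^(|m| - t) boxes of volume 2^t; in each box the values |k_i| are distinct, which gives
2^(|m| - t) 2^(-2 alpha' |m|) zeta(2 alpha'). There are at most (t + 1)^(d - 1) classes of the first
kind for each sign pattern, the classes of the second kind form a geometric tail, and t <= log_2 N
because N e_j lies in the dual lattice.
*)

theory Submission
  imports Defs "HOL-Library.Discrete_Functions"
begin

section \<open>Estimates for the zeta series\<close>

lemma summable_zeta:
  fixes x :: real
  assumes "x > 1"
  shows "summable (\<lambda>n. 1 / real (Suc n) powr x)"
proof -
  have "summable (\<lambda>n. real n powr (- x))"
    using assms by (simp add: summable_real_powr_iff)
  then have "summable (\<lambda>n. real (Suc n) powr (- x))"
    by (subst summable_Suc_iff)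
  then show ?thesis
    by (simp add: powr_minus_divide)
qed

lemma sum_powr_le_zeta:
  fixes x :: real and A :: "nat set"
  assumes "x > 1" "finite A" "0 \<notin> A"
  shows "(\<Sum>n\<in>A. real n powr (- x)) \<le> zeta x"
proof -
  have inj: "inj_on (\<lambda>n. n - 1) A"
  proof (rule inj_onI)
    fix m n assume "m \<in> A" "n \<in> A" "m - 1 = n - 1"
    then show "m = n" using assms(3) by (cases m; cases n) auto
  qed
  have "(\<Sum>n\<in>A. real n powr (- x)) = (\<Sum>n\<in>A. 1 / real (Suc (n - 1)) powr x)"
  proof (rule sum.cong)
    fix n assume "n \<in> A"
    then have "Suc (n - 1) = n" using assms(3) by (cases n) auto
    then show "real n powr (- x) = 1 / real (Suc (n - 1)) powr x"
      by (simp only: powr_minus_divide)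
  qed simp
  also have "\<dots> = (\<Sum>n\<in>(\<lambda>n. n - 1) ` A. 1 / real (Suc n) powr x)"
    using inj by (simp add: sum.reindex)
  also have "\<dots> \<le> zeta x"
    unfolding zeta_def
    using assms by (intro sum_le_suminf summable_zeta) auto
  finally show ?thesis .
qed

lemma zeta_ge_1:
  assumes "x > 1"
  shows "zeta x \<ge> 1"
  using sum_powr_le_zeta[of x "{1}"] assms by simp

text \<open>Condensation: the block 2^k <= n < 2^(k+1) has 2^k terms, each at most 2^(-k x), so it
  contributes at most q^k with q = 2^(1 - x). The bound lets \<open>finite_sum_le\<close> trade a
  factor \<open>zeta a\<close> for a geometric series constant.\<close>

lemma zeta_le_geometric:
  assumes x: "x > 1"
  shows "zeta x \<le> 1 / (1 - 2 powr (1 - x))"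
proof -
  define q where "q = 2 powr (1 - x)"
  have q: "0 < q" "q < 1"
    using x by (auto simp: q_def powr_less_one)
  let ?f = "\<lambda>n. 1 / real (Suc n) powr x"
  have dyadic: "(\<Sum>n<2 ^ k - 1. ?f n) \<le> (\<Sum>m<k. q ^ m)" for k :: nat
  proof (induction k)
    case (Suc k)
    have one: "(1::nat) \<le> 2 ^ k" by simp
    have "(\<Sum>n<2 ^ Suc k - 1. ?f n) = (\<Sum>n<2 ^ k - 1. ?f n) + (\<Sum>n\<in>{2 ^ k - 1..<2 ^ Suc k - 1}. ?f n)"
      by (subst sum.union_disjoint[symmetric]) (auto intro!: sum.cong)
    also have "(\<Sum>n\<in>{2 ^ k - 1..<2 ^ Suc k - 1}. ?f n) \<le> (\<Sum>n\<in>{2 ^ k - 1..<2 ^ Suc k - 1::nat}. 1 / (2 ^ k) powr x)"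
    proof (rule sum_mono)
      fix n :: nat assume "n \<in> {2 ^ k - 1..<2 ^ Suc k - 1}"
      then have "2 ^ k \<le> Suc n" by auto
      then have "real (2 ^ k) \<le> real (Suc n)" by (rule of_nat_mono)
      then show "?f n \<le> 1 / (2 ^ k) powr x"
        using x by (intro divide_left_mono powr_mono2 mult_pos_pos) auto
    qed
    also have "\<dots> = 2 ^ k / (2 ^ k) powr x"
      using one by (simp add: of_nat_diff)
    also have "\<dots> = 2 powr real k / (2 powr real k) powr x"
      by (simp add: powr_realpow)
    also have "\<dots> = q ^ k"
      by (simp add: q_def powr_powr powr_power powr_diff[symmetric] algebra_simps)
    finally show ?case using Suc.IH by simp
  qed simp
  have "(\<Sum>n<k. ?f n) \<le> 1 / (1 - q)" for k
  proof -
    have "k \<le> 2 ^ k - 1" using less_exp[of k] by linarith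
    then have "(\<Sum>n<k. ?f n) \<le> (\<Sum>n<2 ^ k - 1. ?f n)"
      by (intro sum_mono2) auto
    also have "\<dots> \<le> (\<Sum>m<k. q ^ m)" by (rule dyadic)
    also have "\<dots> \<le> 1 / (1 - q)"
      using q by (simp add: sum_gp_strict divide_simps)
    finally show ?thesis .
  qed
  then show ?thesis
    unfolding zeta_def q_def[symmetric]
    by (intro suminf_le_const summable_zeta x) auto
qed

section \<open>Exponent vectors: tail sums, binomial coefficients, choice of smaller
  exponents\<close>

lemma sum_PiE_insert:
  assumes "finite v" "x \<notin> v" "finite S"
  shows "(\<Sum>m\<in>insert x v \<rightarrow>\<^sub>E S. f m) = (\<Sum>a\<in>S. \<Sum>g\<in>v \<rightarrow>\<^sub>E S. f (g(x := a)))"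
proof -
  have "(\<Sum>m\<in>insert x v \<rightarrow>\<^sub>E S. f m) = (\<Sum>(a, g)\<in>S \<times> (v \<rightarrow>\<^sub>E S). f (g(x := a)))"
    unfolding PiE_insert_eq
    by (subst sum.reindex) (use assms inj_combinator in \<open>auto simp: case_prod_unfold\<close>)
  then show ?thesis by (simp add: sum.cartesian_product)
qed

text \<open>Reversing the order of summation gives the hockey-stick identity. For n = 0 the
  truncated subtraction leaves only the term \<open>(0 - 1) choose 0 = 1\<close>, so the identity
  survives.\<close>

lemma sum_choose_diff:
  "(\<Sum>j\<le>T. (T - j + n - 1) choose (T - j)) = (T + n) choose T" for T n :: nat
proof -
  have "(\<Sum>j\<le>T. (T - j + n - 1) choose (T - j)) = (\<Sum>j\<le>T. (j + n - 1) choose j)"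
    using sum.nat_diff_reindex[of "\<lambda>j. (j + n - 1) choose j" "Suc T"]
    by (simp add: lessThan_Suc_atMost)
  also have "\<dots> = (T + n) choose T"
  proof (cases n)
    case 0
    have "(\<Sum>j\<le>T. (j - 1) choose j) = (\<Sum>j\<in>{0}. (j - 1) choose j)"
      by (rule sum.mono_neutral_right) (auto simp: binomial_eq_0)
    then show ?thesis using 0 by simp
  next
    case (Suc n')
    then show ?thesis using sum_choose_lower[of n' T] by (simp add: add.commute)
  qed
  finally show ?thesis .
qed

text \<open>Induction on the number of coordinates. If the new coordinate is a, the others must sum
  to at least T - a, which is no condition for a >= T. The values a <= T all carry the same power
  q^T, and their binomial coefficients add up by \<open>sum_choose_diff\<close>; the values a > T
  form a geometric tail of size at most q^T * q b, where b = 1 / (1 - q). Since 1 + q b = b,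
  together they yield one more factor b. The cutoff K only makes the sum finite and is absent from
  the bound.\<close>

lemma sum_geometric_tail:
  fixes q :: real and T K :: nat
  assumes v: "finite v" and q: "0 < q" "q < 1"
  shows "(\<Sum>m\<in>v \<rightarrow>\<^sub>E {..K}. if T \<le> sum m v then q ^ sum m v else 0)
    \<le> q ^ T * (1 / (1 - q)) ^ card v * real ((T + card v - 1) choose T)"
  using v
proof (induction v arbitrary: T rule: finite_induct)
  case empty
  then show ?case using q by (cases T) auto
next
  case (insert x v)
  define b where "b = 1 / (1 - q)"
  let ?n = "card v"
  let ?G = "\<lambda>T. \<Sum>g\<in>v \<rightarrow>\<^sub>E {..K}. if T \<le> sum g v then q ^ sum g v else 0"
  have b: "b \<ge> 1" "b = 1 + q * b" "b > 0"
    using q by (auto simp: b_def field_simps)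
  have eq: "sum (g(x := a)) (insert x v) = a + sum g v" for g and a :: nat
  proof -
    have "sum (g(x := a)) v = sum g v"
      using insert.hyps by (intro sum.cong) auto
    then show ?thesis using insert.hyps by simp
  qed
  have "(\<Sum>m\<in>insert x v \<rightarrow>\<^sub>E {..K}. if T \<le> sum m (insert x v) then q ^ sum m (insert x v) else 0)
      = (\<Sum>a\<le>K. \<Sum>g\<in>v \<rightarrow>\<^sub>E {..K}. if T \<le> a + sum g v then q ^ (a + sum g v) else 0)"
    by (simp only: sum_PiE_insert[OF insert.hyps finite_atMost] eq)
  also have "\<dots> = (\<Sum>a\<le>K. q ^ a * ?G (T - a))"
    by (intro sum.cong refl) (simp add: sum_distrib_left power_add if_distrib le_diff_conv add.commute cong: if_cong)
  also have "\<dots> \<le> (\<Sum>a\<le>K. q ^ a * (q ^ (T - a) * b ^ ?n * real ((T - a + ?n - 1) choose (T - a))))"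
    using q unfolding b_def by (intro sum_mono mult_left_mono insert.IH) auto
  \<comment> \<open>The longer range contains 0..T whatever the size of K, so it can be split at
    T.\<close>
  also have "\<dots> \<le> (\<Sum>a\<le>T + Suc K. q ^ a * (q ^ (T - a) * b ^ ?n * real ((T - a + ?n - 1) choose (T - a))))"
    using q b by (intro sum_mono2) auto
  also have "\<dots> = (\<Sum>a\<le>T. q ^ a * (q ^ (T - a) * b ^ ?n * real ((T - a + ?n - 1) choose (T - a))))
      + (\<Sum>a=Suc T..T + Suc K. q ^ a * (q ^ (T - a) * b ^ ?n * real ((T - a + ?n - 1) choose (T - a))))"
  proof -
    have split: "{..T + Suc K} = {..T} \<union> {Suc T..T + Suc K}" by auto
    show ?thesis unfolding split by (rule sum.union_disjoint) auto
  qed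
  also have "(\<Sum>a\<le>T. q ^ a * (q ^ (T - a) * b ^ ?n * real ((T - a + ?n - 1) choose (T - a))))
      = (\<Sum>a\<le>T. q ^ T * b ^ ?n * real ((T - a + ?n - 1) choose (T - a)))"
    by (intro sum.cong refl) (simp flip: power_add mult.assoc)
  also have "\<dots> = q ^ T * b ^ ?n * real ((T + ?n) choose T)"
    by (simp only: sum_distrib_left[symmetric] of_nat_sum[symmetric] sum_choose_diff)
  also have "(\<Sum>a=Suc T..T + Suc K. q ^ a * (q ^ (T - a) * b ^ ?n * real ((T - a + ?n - 1) choose (T - a))))
      = b ^ ?n * (\<Sum>a=Suc T..T + Suc K. q ^ a)"
    unfolding sum_distrib_left by (intro sum.cong) (auto simp: mult.commute)
  also have "(\<Sum>a=Suc T..T + Suc K. q ^ a) \<le> q ^ T * (q * b)"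
    using q by (subst sum_gp) (simp add: b_def divide_simps)
  also have "b ^ ?n * (q ^ T * (q * b)) \<le> b ^ ?n * (q ^ T * (q * b)) * real ((T + ?n) choose T)"
  proof -
    have "(T + ?n) choose T \<ge> 1"
      using zero_less_binomial[of T "T + ?n"] by linarith
    then have "real ((T + ?n) choose T) \<ge> 1" by linarith
    moreover have "0 \<le> b ^ ?n * (q ^ T * (q * b))"
      using q b by (intro mult_nonneg_nonneg) auto
    ultimately show ?thesis using mult_left_mono[of 1 "real ((T + ?n) choose T)"] by simp
  qed
  also have "q ^ T * b ^ ?n * real ((T + ?n) choose T) + b ^ ?n * (q ^ T * (q * b)) * real ((T + ?n) choose T)
      = q ^ T * b ^ ?n * (1 + q * b) * real ((T + ?n) choose T)"
    by (simp add: algebra_simps)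
  also have "\<dots> = q ^ T * b ^ card (insert x v) * real ((T + card (insert x v) - 1) choose T)"
    using insert.hyps by (simp flip: b(2))
  finally show ?case
    using q b by (simp add: b_def mult_left_mono)
qed

text \<open>For n >= 2 the quotient of consecutive coefficients, (t + n + 1) / n, is at most 2
  \<open>max t 1\<close>, and induction applies. The coefficient is the one in
  \<open>sum_geometric_tail\<close> for T = t + 1. The base uses \<open>max t 1\<close> because
  this, unlike t + 1, is bounded by log_2 N in the application.\<close>

lemma choose_le_power:
  fixes t n :: nat
  shows "real ((t + n) choose Suc t) \<le> (2 * real (max t 1)) ^ n"
proof (induction n)
  case (Suc n)
  define \<tau> where "\<tau> = real (max t 1)"
  have \<tau>: "\<tau> \<ge> 1" "real t \<le> \<tau>" by (auto simp: \<tau>_def)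
  consider "n = 0" | "n = 1" | "n \<ge> 2" by linarith
  then show ?case
  proof cases
    case 1
    then show ?thesis by simp
  next
    \<comment> \<open>Here the quotient is t + 2, which exceeds 2 \<open>max t 1\<close> when t = 1,
      so the coefficient is computed directly.\<close>
    case 2
    have "real t + 2 \<le> 4 * (\<tau> * \<tau>)"
      using \<tau> mult_right_mono[of 1 \<tau> \<tau>] by linarith
    moreover have "(t + Suc n) choose Suc t = t + 2"
      using 2 binomial_Suc_n[of "Suc t"] by simp
    ultimately show ?thesis
      using 2 by (simp add: \<tau>_def power2_eq_square numeral_2_eq_2)
  next
    case 3
    have "n * ((t + Suc n) choose Suc t) = (t + Suc n) * ((t + n) choose Suc t)"
    proof -
      have "(t + Suc n - Suc t) * ((t + Suc n) choose Suc t) = (t + Suc n) * ((t + Suc n - 1) choose Suc t)"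
        using binomial_absorb_comp[of "t + Suc n" "Suc t"] by simp
      then show ?thesis by simp
    qed
    then have "real n * real ((t + Suc n) choose Suc t) = real (t + Suc n) * real ((t + n) choose Suc t)"
      unfolding of_nat_mult[symmetric] by (simp only:)
    also have "real (t + Suc n) = real t + real n + 1" by simp
    also have "(real t + real n + 1) * real ((t + n) choose Suc t) \<le> (real n * (2 * \<tau>)) * (2 * \<tau>) ^ n"
    proof (rule mult_mono)
      have "(real n - 2) + (\<tau> - 1) * (2 * real n - 1) \<ge> 0"
        using 3 \<tau> by (intro add_nonneg_nonneg mult_nonneg_nonneg) auto
      then show "real t + real n + 1 \<le> real n * (2 * \<tau>)"
        using \<tau> by (simp add: algebra_simps)
    qed (use Suc.IH \<tau> in \<open>auto simp: \<tau>_def\<close>)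
    finally show ?thesis
      using 3 by (simp add: \<tau>_def mult.assoc)
  qed
qed (simp add: binomial_eq_0)

text \<open>Greedy choice: one coordinate x takes \<open>min t (m x)\<close>, the others share the
  rest. It supplies the side exponents of the boxes of volume 2^t in
  \<open>sum_class_dense\<close>.\<close>

lemma exists_smaller_summands:
  fixes m :: "'i \<Rightarrow> nat"
  assumes "finite v" "t \<le> sum m v"
  shows "\<exists>l. (\<forall>j\<in>v. l j \<le> m j) \<and> sum l v = t"
  using assms
proof (induction v arbitrary: t rule: finite_induct)
  case (insert x v)
  obtain l where l: "\<forall>j\<in>v. l j \<le> m j" "sum l v = t - min t (m x)"
  proof -
    have "t - min t (m x) \<le> sum m v" using insert.prems insert.hyps by simp
    then show ?thesis using insert.IH that by blast
  qed
  let ?l = "l(x := min t (m x))"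
  have "sum ?l v = sum l v"
    using insert.hyps by (intro sum.cong) auto
  then show ?case
    using l insert.hyps by (intro exI[of _ ?l]) auto
qed simp

section \<open>Integer vectors with large products of differences, and their dyadic classes\<close>

lemma floor_eq_imp_diff_less:
  fixes x y Q :: real
  assumes "Q > 0" "\<lfloor>x / Q\<rfloor> = \<lfloor>y / Q\<rfloor>"
  shows "\<bar>x - y\<bar> < Q"
proof -
  have "\<bar>x / Q - y / Q\<bar> < 1" using assms(2) by linarith
  then have "\<bar>x - y\<bar> / Q < 1"
    using assms(1) by (simp add: diff_divide_distrib[symmetric] abs_divide)
  then show ?thesis using assms(1) by simp
qed

text \<open>Isolates what the counting argument takes from the dual lattice. Two distinct vectors
  may agree in some coordinates; \<open>max 1\<close> keeps these from making the product
  zero.\<close>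

locale separated_vectors =
  fixes u :: "'i set" and D :: "('i \<Rightarrow> int) set" and r :: real
  assumes finite_u: "finite u"
    and r_ge_1: "1 \<le> r"
    and D_sub: "D \<subseteq> u \<rightarrow>\<^sub>E (UNIV - {0})"
    and r_le_prod: "\<And>k. k \<in> D \<Longrightarrow> r \<le> (\<Prod>j\<in>u. real_of_int \<bar>k j\<bar>)"
    and r_le_prod_diff: "\<And>k k'. k \<in> D \<Longrightarrow> k' \<in> D \<Longrightarrow> k \<noteq> k' \<Longrightarrow>
      r \<le> (\<Prod>j\<in>u. max 1 (real_of_int \<bar>k j - k' j\<bar>))"
begin

text \<open>If the vectors differed at i, then \<open>max 1\<close> of their distance there would be
  the distance itself, strictly below b_i; the other factors are at most b_j because b_j >= 1. The
  product would be below r. Both class estimates get their injectivity from this lemma, with a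
  suitable box of volume at most r.\<close>

lemma eq_if_close:
  fixes b :: "'i \<Rightarrow> real"
  assumes k: "k \<in> D" "k' \<in> D"
    and b: "\<And>j. j \<in> u \<Longrightarrow> 1 \<le> b j" "\<And>j. j \<in> u \<Longrightarrow> real_of_int \<bar>k j - k' j\<bar> < b j"
    and r: "(\<Prod>j\<in>u. b j) \<le> r"
  shows "k = k'"
proof (rule ccontr)
  assume "k \<noteq> k'"
  let ?\<Delta> = "\<lambda>j. real_of_int \<bar>k j - k' j\<bar>"
  have ext: "k \<in> extensional u" "k' \<in> extensional u"
    using k D_sub by (auto simp: PiE_def)
  obtain i where i: "i \<in> u" "k i \<noteq> k' i"
    using \<open>k \<noteq> k'\<close> extensionalityI[OF ext] by blast
  then have "?\<Delta> i \<ge> 1" by linarith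
  then have "(\<Prod>j\<in>u. max 1 (?\<Delta> j)) = ?\<Delta> i * (\<Prod>j\<in>u - {i}. max 1 (?\<Delta> j))"
    using i finite_u by (simp add: prod.remove max_def)
  also have "\<dots> < b i * (\<Prod>j\<in>u - {i}. max 1 (?\<Delta> j))"
    using b(2)[OF i(1)] by (intro mult_strict_right_mono prod_pos) auto
  also have "\<dots> \<le> b i * (\<Prod>j\<in>u - {i}. b j)"
    using b i by (intro mult_left_mono prod_mono) (force intro: order.trans[of 0 1] less_imp_le)+
  also have "\<dots> = (\<Prod>j\<in>u. b j)"
    using i finite_u by (simp add: prod.remove)
  finally show False
    using r r_le_prod_diff[OF k \<open>k \<noteq> k'\<close>] by linarith
qed

text \<open>Signs are recorded on all of \<open>u\<close>, so that within a class differences of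
  entries are differences of absolute values. Sizes are recorded only on \<open>v\<close>, later
  \<open>u\<close> without i: the coordinate i stays free as summation variable. Both components are
  extensional, so classes can be counted as elements of \<open>PiE\<close> sets.\<close>

definition dyadic_class :: "'i set \<Rightarrow> ('i \<Rightarrow> int) \<Rightarrow> ('i \<Rightarrow> bool) \<times> ('i \<Rightarrow> nat)" where
  "dyadic_class v k = (\<lambda>j\<in>u. 0 < k j, \<lambda>j\<in>v. floor_log (nat \<bar>k j\<bar>))"

context
  fixes i :: 'i and v :: "'i set"
  assumes i: "i \<in> u" and v_def: "v = u - {i}"
begin

lemma u_eq: "u = insert i v" "i \<notin> v" "finite v" "v \<subseteq> u"
  using i v_def finite_u by auto

lemma dyadic_classD:
  assumes "k \<in> D" "dyadic_class v k = (\<sigma>, m)"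
  shows "\<And>j. j \<in> u \<Longrightarrow> (0 < k j) = \<sigma> j"
    and "\<And>j. j \<in> v \<Longrightarrow> 2 ^ m j \<le> \<bar>k j\<bar>"
    and "\<And>j. j \<in> v \<Longrightarrow> \<bar>k j\<bar> < 2 * 2 ^ m j"
    and "\<And>j. j \<in> u \<Longrightarrow> k j \<noteq> 0"
proof -
  show nz: "k j \<noteq> 0" if "j \<in> u" for j
    using assms(1) D_sub that by (auto simp: PiE_def Pi_def)
  show "(0 < k j) = \<sigma> j" if "j \<in> u" for j
    using assms(2) that by (auto simp: dyadic_class_def)
  fix j assume j: "j \<in> v"
  have m: "m j = floor_log (nat \<bar>k j\<bar>)"
    using assms(2) j by (auto simp: dyadic_class_def)
  have "nat \<bar>k j\<bar> > 0" using nz[of j] j u_eq by auto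
  then have "2 ^ m j \<le> nat \<bar>k j\<bar>"
    unfolding m by (rule floor_log_exp2_le)
  then have "int (2 ^ m j) \<le> int (nat \<bar>k j\<bar>)" by (simp only: of_nat_le_iff)
  then show "2 ^ m j \<le> \<bar>k j\<bar>" by simp
  have "nat \<bar>k j\<bar> < 2 * 2 ^ m j"
    unfolding m by (rule floor_log_exp2_gt)
  then have "int (nat \<bar>k j\<bar>) < int (2 * 2 ^ m j)" by (simp only: of_nat_less_iff)
  then show "\<bar>k j\<bar> < 2 * 2 ^ m j" by simp
qed

lemma diff_eq_abs_diff:
  assumes "k \<in> D" "dyadic_class v k = (\<sigma>, m)" "k' \<in> D" "dyadic_class v k' = (\<sigma>, m)" "j \<in> u"
  shows "\<bar>k j - k' j\<bar> = \<bar>\<bar>k j\<bar> - \<bar>k' j\<bar>\<bar>"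
  using dyadic_classD(1)[OF assms(1,2,5)] dyadic_classD(1)[OF assms(3,4,5)] by linarith

text \<open>Coordinates in \<open>v\<close> are rounded down to their dyadic size, and |k_i| is kept
  exactly.\<close>

lemma weight_le:
  fixes a :: real
  assumes "k \<in> D" "dyadic_class v k = (\<sigma>, m)" and a: "a > 0"
  shows "(\<Prod>j\<in>u. real_of_int \<bar>k j\<bar> powr (- a)) \<le> (2 ^ sum m v * real_of_int \<bar>k i\<bar>) powr (- a)"
proof -
  have "(2 ^ sum m v * real_of_int \<bar>k i\<bar>) \<le> (\<Prod>j\<in>u. real_of_int \<bar>k j\<bar>)"
  proof -
    have "real_of_int (2 ^ m j) \<le> real_of_int \<bar>k j\<bar>" if "j \<in> v" for j
      using dyadic_classD(2)[OF assms(1,2) that] by (rule of_int_le_iff[THEN iffD2])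
    then have "(\<Prod>j\<in>v. 2 ^ m j) \<le> (\<Prod>j\<in>v. real_of_int \<bar>k j\<bar>)"
      by (intro prod_mono) auto
    then have "2 ^ sum m v \<le> (\<Prod>j\<in>v. real_of_int \<bar>k j\<bar>)"
      by (simp add: power_sum)
    then show ?thesis
      using u_eq by (simp add: mult.commute mult_left_mono)
  qed
  moreover have "k i \<noteq> 0" using dyadic_classD(4)[OF assms(1,2) i] .
  ultimately have "(\<Prod>j\<in>u. real_of_int \<bar>k j\<bar>) powr (- a) \<le> (2 ^ sum m v * real_of_int \<bar>k i\<bar>) powr (- a)"
    using a by (intro powr_mono2') auto
  then show ?thesis
    by (simp add: prod_powr_distrib)
qed

text \<open>Let Q = r / 2^|m|, where |m| = \<open>sum m v\<close>. Members of the class differ by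
  less than 2^(m_j) in each coordinate of \<open>v\<close>, so two of them with |k_i| in the same
  interval [n Q, (n + 1) Q) coincide by \<open>eq_if_close\<close>. For n >= 1 the weight is at most
  (2^|m| n Q)^(-a) = (r n)^(-a), which sums to the zeta term. For n = 0 the bound r on the product
  of the entries gives r^(-a), the extra 1.\<close>

lemma sum_class_sparse:
  fixes a :: real
  assumes a: "a > 1" and E: "finite E" "E \<subseteq> {k \<in> D. dyadic_class v k = (\<sigma>, m)}"
    and m: "2 ^ sum m v \<le> r"
  shows "(\<Sum>k\<in>E. \<Prod>j\<in>u. real_of_int \<bar>k j\<bar> powr (- a)) \<le> r powr (- a) * (1 + zeta a)"
proof -
  define Q where "Q = r / 2 ^ sum m v"
  have Q: "Q \<ge> 1" using m by (simp add: Q_def)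
  define n where "n = (\<lambda>k. nat \<lfloor>real_of_int \<bar>k i\<bar> / Q\<rfloor>)"
  have kE: "k \<in> D" "dyadic_class v k = (\<sigma>, m)" if "k \<in> E" for k
    using E that by auto
  have inj: "inj_on n E"
  proof (rule inj_onI)
    fix k k' assume k: "k \<in> E" "k' \<in> E" and "n k = n k'"
    then have "\<lfloor>real_of_int \<bar>k i\<bar> / Q\<rfloor> = \<lfloor>real_of_int \<bar>k' i\<bar> / Q\<rfloor>"
      using Q by (simp add: n_def nat_eq_iff2 split: if_splits)
    then have "\<bar>real_of_int \<bar>k i\<bar> - real_of_int \<bar>k' i\<bar>\<bar> < Q"
      using Q by (intro floor_eq_imp_diff_less) auto
    then have close: "real_of_int \<bar>k i - k' i\<bar> < Q"
      using diff_eq_abs_diff[OF kE[OF k(1)] kE[OF k(2)] i] by simp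
    show "k = k'"
    proof (rule eq_if_close[where b = "\<lambda>j. if j = i then Q else 2 ^ m j"])
      fix j assume j: "j \<in> u"
      show "real_of_int \<bar>k j - k' j\<bar> < (if j = i then Q else 2 ^ m j)"
      proof (cases "j = i")
        case False
        then have "j \<in> v" using j u_eq by auto
        then have "\<bar>k j - k' j\<bar> < 2 ^ m j"
          using diff_eq_abs_diff[OF kE[OF k(1)] kE[OF k(2)] j]
            dyadic_classD(2,3)[OF kE[OF k(1)], of j] dyadic_classD(2,3)[OF kE[OF k(2)], of j]
          by linarith
        then have "real_of_int \<bar>k j - k' j\<bar> < real_of_int (2 ^ m j)" by (simp only: of_int_less_iff)
        then show ?thesis using False by simp
      qed (use close in simp)
    next
      have "(\<Prod>j\<in>v. if j = i then Q else 2 ^ m j) = (\<Prod>j\<in>v. 2 ^ m j)"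
        using u_eq(2) by (intro prod.cong) auto
      then have "(\<Prod>j\<in>u. if j = i then Q else 2 ^ m j) = Q * (\<Prod>j\<in>v. 2 ^ m j)"
        unfolding u_eq(1) using u_eq(2,3) by simp
      then show "(\<Prod>j\<in>u. if j = i then Q else 2 ^ m j) \<le> r"
        by (simp add: Q_def power_sum[symmetric])
    qed (use k kE Q in auto)
  qed
  have weight: "(\<Prod>j\<in>u. real_of_int \<bar>k j\<bar> powr (- a))
      \<le> r powr (- a) * (if n k = 0 then 1 else real (n k) powr (- a))" if k: "k \<in> E" for k
  proof (cases "n k = 0")
    case True
    have "(\<Prod>j\<in>u. real_of_int \<bar>k j\<bar>) powr (- a) \<le> r powr (- a)"
      using r_le_prod[OF kE(1)[OF k]] r_ge_1 a by (intro powr_mono2') auto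
    then show ?thesis using True by (simp add: prod_powr_distrib)
  next
    case False
    have "real (n k) \<le> real_of_int \<bar>k i\<bar> / Q"
      using Q by (simp add: n_def)
    then have "r * real (n k) \<le> 2 ^ sum m v * real_of_int \<bar>k i\<bar>"
      using r_ge_1 by (simp add: Q_def field_simps)
    then have "(2 ^ sum m v * real_of_int \<bar>k i\<bar>) powr (- a) \<le> (r * real (n k)) powr (- a)"
      using False r_ge_1 a by (intro powr_mono2') auto
    then show ?thesis
      using weight_le[OF kE[OF k], of a] a False r_ge_1 by (simp add: powr_mult)
  qed
  have "(\<Sum>k\<in>E. \<Prod>j\<in>u. real_of_int \<bar>k j\<bar> powr (- a))
      \<le> (\<Sum>k\<in>E. r powr (- a) * (if n k = 0 then 1 else real (n k) powr (- a)))"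
    by (rule sum_mono) (rule weight)
  also have "\<dots> = r powr (- a) * (\<Sum>h\<in>n ` E. if h = 0 then 1 else real h powr (- a))"
    by (simp add: sum.reindex[OF inj] sum_distrib_left)
  \<comment> \<open>The index 0 may or may not occur; forcing it in makes the bound uniform.\<close>
  also have "(\<Sum>h\<in>n ` E. if h = 0 then 1 else real h powr (- a))
      \<le> (\<Sum>h\<in>insert 0 (n ` E - {0}). if h = 0 then 1 else real h powr (- a))"
    using E by (intro sum_mono2) auto
  also have "\<dots> = 1 + (\<Sum>h\<in>n ` E - {0}. real h powr (- a))"
    using E by (subst sum.insert) (auto intro!: sum.cong)
  also have "\<dots> \<le> 1 + zeta a"
    using E a by (intro add_left_mono sum_powr_le_zeta) auto
  finally show ?thesis by (simp add: mult_left_mono)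
qed

text \<open>With l <= m and |l| = t, cut each range [2^(m_j), 2^(m_j + 1)) into 2^(m_j - l_j) pieces
  of length 2^(l_j). Since 2^t <= r, the box and the value |k_i| determine the vector. Each of the
  2^(|m| - t) boxes contributes at most 2^(-a |m|) \<open>zeta a\<close>.\<close>

lemma sum_class_dense:
  fixes a :: real
  assumes a: "a > 1" and E: "finite E" "E \<subseteq> {k \<in> D. dyadic_class v k = (\<sigma>, m)}"
    and t: "2 ^ t \<le> r" "t \<le> sum m v"
  shows "(\<Sum>k\<in>E. \<Prod>j\<in>u. real_of_int \<bar>k j\<bar> powr (- a))
    \<le> zeta a * (2 powr (1 - a)) ^ sum m v / 2 ^ t"
proof -
  obtain l where l: "\<And>j. j \<in> v \<Longrightarrow> l j \<le> m j" "sum l v = t"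
    using exists_smaller_summands[OF u_eq(3) t(2)] by blast
  define q where "q = (\<lambda>k. \<lambda>j\<in>v. (nat \<bar>k j\<bar> - 2 ^ m j) div 2 ^ l j)"
  define B where "B = Pi\<^sub>E v (\<lambda>j. {..<2 ^ (m j - l j) :: nat})"
  define h where "h = (\<lambda>k. (q k, nat \<bar>k i\<bar>))"
  have kE: "k \<in> D" "dyadic_class v k = (\<sigma>, m)" if "k \<in> E" for k
    using E that by auto
  have bounds: "2 ^ m j \<le> nat \<bar>k j\<bar>" "nat \<bar>k j\<bar> - 2 ^ m j < 2 ^ m j" if "k \<in> E" "j \<in> v" for k j
    using dyadic_classD(2,3)[OF kE[OF that(1)] that(2)]
    by (simp_all add: le_nat_iff nat_less_iff nat_diff_distrib less_diff_conv2)
  have inj: "inj_on h E"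
  proof (rule inj_onI)
    fix k k' assume k: "k \<in> E" "k' \<in> E" and hh: "h k = h k'"
    \<comment> \<open>The side 1 at i expresses equality there: an integer distance below 1 is
      zero.\<close>
    show "k = k'"
    proof (rule eq_if_close[where b = "\<lambda>j. if j = i then 1 else 2 ^ l j"])
      fix j assume j: "j \<in> u"
      note abs = diff_eq_abs_diff[OF kE[OF k(1)] kE[OF k(2)] j]
      show "real_of_int \<bar>k j - k' j\<bar> < (if j = i then 1 else 2 ^ l j)"
      proof (cases "j = i")
        case True
        then show ?thesis using hh abs by (simp add: h_def nat_eq_iff)
      next
        case False
        then have jv: "j \<in> v" using j u_eq by auto
        define x y where "x = nat \<bar>k j\<bar> - 2 ^ m j" and "y = nat \<bar>k' j\<bar> - 2 ^ m j"
        have "x div 2 ^ l j = y div 2 ^ l j"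
        proof -
          have "q k j = q k' j" using hh by (simp add: h_def)
          then show ?thesis using jv by (simp add: q_def x_def y_def)
        qed
        then have "x = y div 2 ^ l j * 2 ^ l j + x mod 2 ^ l j"
          using div_mult_mod_eq[of x "2 ^ l j"] by simp
        moreover have "y = y div 2 ^ l j * 2 ^ l j + y mod 2 ^ l j"
          by (rule div_mult_mod_eq[symmetric])
        moreover have "x mod 2 ^ l j < 2 ^ l j" "y mod 2 ^ l j < 2 ^ l j"
          by simp_all
        ultimately have "\<bar>int x - int y\<bar> < int (2 ^ l j)"
          by linarith
        moreover have "int x - int y = \<bar>k j\<bar> - \<bar>k' j\<bar>"
          using bounds(1)[OF k(1) jv] bounds(1)[OF k(2) jv] by (simp add: x_def y_def of_nat_diff)
        ultimately have "\<bar>k j - k' j\<bar> < 2 ^ l j"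
          using abs by simp
        then have "real_of_int \<bar>k j - k' j\<bar> < real_of_int (2 ^ l j)" by (simp only: of_int_less_iff)
        then show ?thesis using False by simp
      qed
    next
      have "(\<Prod>j\<in>v. if j = i then 1 else 2 ^ l j :: real) = (\<Prod>j\<in>v. 2 ^ l j)"
        using u_eq(2) by (intro prod.cong) auto
      then have "(\<Prod>j\<in>u. if j = i then 1 else 2 ^ l j :: real) = (\<Prod>j\<in>v. 2 ^ l j)"
        unfolding u_eq(1) using u_eq(2,3) by simp
      then show "(\<Prod>j\<in>u. if j = i then 1 else 2 ^ l j) \<le> r"
        using l(2) t(1) by (simp add: power_sum[symmetric])
    qed (use k kE in auto)
  qed
  have hB: "h ` E \<subseteq> B \<times> snd ` h ` E"
  proof -
    have "q k \<in> B" if "k \<in> E" for k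
    proof -
      have "(nat \<bar>k j\<bar> - 2 ^ m j) div 2 ^ l j < 2 ^ (m j - l j)" if "j \<in> v" for j
        using bounds(2)[OF \<open>k \<in> E\<close> that] l(1)[OF that]
        by (simp add: div_less_iff_less_mult power_add[symmetric])
      then show ?thesis by (auto simp: q_def B_def)
    qed
    then show ?thesis by (force simp: h_def)
  qed
  have finB: "finite B" unfolding B_def using u_eq by (intro finite_PiE) auto
  have cardB: "real (card B) = 2 ^ (sum m v - t)"
  proof -
    have "card B = (\<Prod>j\<in>v. 2 ^ (m j - l j))"
      unfolding B_def using u_eq by (simp add: card_PiE)
    also have "\<dots> = 2 ^ (\<Sum>j\<in>v. m j - l j)" by (simp add: power_sum)
    also have "(\<Sum>j\<in>v. m j - l j) = sum m v - t"
      using l by (simp add: sum_subtractf_nat)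
    finally show ?thesis by simp
  qed
  let ?c = "(2 ^ sum m v) powr (- a) :: real"
  have "(\<Sum>k\<in>E. \<Prod>j\<in>u. real_of_int \<bar>k j\<bar> powr (- a)) \<le> (\<Sum>k\<in>E. ?c * real (snd (h k)) powr (- a))"
  proof (rule sum_mono)
    fix k assume k: "k \<in> E"
    show "(\<Prod>j\<in>u. real_of_int \<bar>k j\<bar> powr (- a)) \<le> ?c * real (snd (h k)) powr (- a)"
      using weight_le[OF kE[OF k], of a] a by (simp add: h_def powr_mult)
  qed
  also have "\<dots> = ?c * (\<Sum>p\<in>h ` E. real (snd p) powr (- a))"
    by (simp add: sum.reindex[OF inj] sum_distrib_left)
  \<comment> \<open>Allowing every box to meet every occurring value of |k_i| turns the sum into a
    product.\<close>
  also have "\<dots> \<le> ?c * (\<Sum>p\<in>B \<times> snd ` h ` E. real (snd p) powr (- a))"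
    using hB finB E by (intro mult_left_mono sum_mono2) auto
  also have "(\<Sum>p\<in>B \<times> snd ` h ` E. real (snd p) powr (- a))
      = real (card B) * (\<Sum>n\<in>snd ` h ` E. real n powr (- a))"
    by (simp add: sum.cartesian_product' del: image_image)
  also have "\<dots> \<le> real (card B) * zeta a"
  proof (intro mult_left_mono sum_powr_le_zeta)
    show "0 \<notin> snd ` h ` E"
      using kE dyadic_classD(4)[OF _ _ i] by (auto simp: h_def)
  qed (use a E in auto)
  also have "?c * (real (card B) * zeta a) = zeta a * (2 powr (1 - a)) ^ sum m v / 2 ^ t"
  proof -
    have "?c = (2 powr (- a)) ^ sum m v"
      by (simp add: powr_power powr_powr mult.commute flip: powr_realpow)
    moreover have "(2 powr (1 - a)) ^ sum m v = 2 ^ sum m v * (2 powr (- a)) ^ sum m v"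
      by (simp add: powr_diff powr_minus power_divide power_inverse divide_inverse power_mult_distrib)
    ultimately show ?thesis
      using t(2) by (simp add: cardB power_diff)
  qed
  finally show ?thesis by (simp add: mult_left_mono)
qed

end

text \<open>Adds the class estimates over the 2^d sign patterns, d = \<open>card u\<close>, and all
  exponent vectors, split at |m| <= t: at most (t + 1)^(d - 1) sparse exponent vectors, and a
  geometric tail from t + 1 on for the dense ones. The bound does not depend on F and therefore
  passes to the infinite sum.\<close>

lemma finite_sum_le:
  fixes a L :: real
  assumes a: "a > 1" and F: "finite F" "F \<subseteq> D" and u: "u \<noteq> {}"
    and L: "1 \<le> L" "log 2 r \<le> L"
  shows "(\<Sum>k\<in>F. \<Prod>j\<in>u. real_of_int \<bar>k j\<bar> powr (- a))
    \<le> r powr (- a) * (1 + zeta a) * (4 / (1 - 2 powr (1 - a))) ^ card u * L ^ (card u - 1)"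
proof -
  obtain i where i: "i \<in> u" using u by blast
  define v where "v = u - {i}"
  note u_eq = u_eq[OF i v_def]
  define n where "n = card v"
  have card_u: "card u = Suc n" using u_eq by (simp add: n_def)
  define q where "q = 2 powr (1 - a)"
  have q: "0 < q" "q < 1" using a by (auto simp: q_def powr_less_one)
  define b where "b = 1 / (1 - q)"
  \<comment> \<open>Thus 2^t <= r <= 2^(t + 1). Replacing t by \<open>max t 1\<close> below keeps t
    + 1 <= 2 \<open>\<tau>\<close> when t = 0.\<close>
  define t where "t = nat \<lfloor>log 2 r\<rfloor>"
  define \<tau> where "\<tau> = real (max t 1)"
  have log_r: "0 \<le> log 2 r" using r_ge_1 by simp
  then have t_real: "real t \<le> log 2 r" "log 2 r < real t + 1"
    unfolding t_def by linarith+
  have t: "2 ^ t \<le> r" "r \<le> 2 ^ Suc t"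
  proof -
    have "2 powr real t \<le> r"
      using t_real(1) r_ge_1 by (simp add: le_log_iff)
    then show "2 ^ t \<le> r" by (simp add: powr_realpow)
    have "r \<le> 2 powr real (Suc t)"
      using t_real(2) r_ge_1 by (subst log_le_iff[symmetric]) auto
    then show "r \<le> 2 ^ Suc t" by (simp only: powr_realpow zero_less_numeral)
  qed
  have \<tau>: "1 \<le> \<tau>" "\<tau> \<le> L" "real t + 1 \<le> 2 * \<tau>"
    using L t_real by (auto simp: \<tau>_def max_def)
  \<comment> \<open>A crude common bound for all dyadic exponents occurring in F, so that finitely
    many classes suffice.\<close>
  define K where "K = (\<Sum>k\<in>F. \<Sum>j\<in>v. floor_log (nat \<bar>k j\<bar>))"
  define S where "S = u \<rightarrow>\<^sub>E (UNIV :: bool set)"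
  define M where "M = v \<rightarrow>\<^sub>E {..K}"
  have fin: "finite S" "finite M"
    using u_eq finite_u by (auto simp: S_def M_def intro!: finite_PiE)
  have card_S: "card S = 2 ^ Suc n"
    using finite_u by (simp add: S_def card_PiE card_u)
  have classes: "dyadic_class v ` F \<subseteq> S \<times> M"
  proof -
    have "floor_log (nat \<bar>k j\<bar>) \<le> K" if "k \<in> F" "j \<in> v" for k j
    proof -
      have "floor_log (nat \<bar>k j\<bar>) \<le> (\<Sum>j\<in>v. floor_log (nat \<bar>k j\<bar>))"
        using that u_eq by (intro member_le_sum) auto
      also have "\<dots> \<le> K"
        unfolding K_def
        using member_le_sum[of k F "\<lambda>k. \<Sum>j\<in>v. floor_log (nat \<bar>k j\<bar>)"] that F by simp
      finally show ?thesis .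
    qed
    then show ?thesis by (auto simp: dyadic_class_def S_def M_def)
  qed
  let ?w = "\<lambda>k. \<Prod>j\<in>u. real_of_int \<bar>k j\<bar> powr (- a)"
  define A where "A = r powr (- a) * (1 + zeta a)"
  define W where "W = (\<lambda>m. if sum m v \<le> t then A else zeta a * q ^ sum m v / 2 ^ t)"
  note zeta = zeta_ge_1[OF a]
  have A: "A \<ge> 0" using zeta by (simp add: A_def)
  have W: "W m \<ge> 0" for m using A zeta q by (simp add: W_def)
  have "(\<Sum>m\<in>M. W m) = A * real (card {m \<in> M. sum m v \<le> t})
      + zeta a / 2 ^ t * (\<Sum>m\<in>M. if Suc t \<le> sum m v then q ^ sum m v else 0)"
  proof -
    have "(\<Sum>m\<in>M. W m) = (\<Sum>m\<in>M. (if sum m v \<le> t then A else 0)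
        + zeta a / 2 ^ t * (if Suc t \<le> sum m v then q ^ sum m v else 0))"
      by (intro sum.cong) (auto simp: W_def)
    moreover have "(\<Sum>m\<in>M. if sum m v \<le> t then A else 0) = A * real (card {m \<in> M. sum m v \<le> t})"
      using fin(2) by (simp add: sum.inter_filter[symmetric] mult.commute)
    ultimately show ?thesis by (simp only: sum.distrib sum_distrib_left)
  qed
  also have "\<dots> \<le> A * (2 * \<tau>) ^ n + 2 * zeta a * r powr (- a) * b ^ n * (2 * \<tau>) ^ n"
  proof (rule add_mono)
    have "{m \<in> M. sum m v \<le> t} \<subseteq> v \<rightarrow>\<^sub>E {..t}"
    proof
      fix m assume m: "m \<in> {m \<in> M. sum m v \<le> t}"
      have "m j \<le> t" if "j \<in> v" for j
      proof -
        have "m j \<le> sum m v" using that u_eq(3) by (intro member_le_sum) auto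
        then show ?thesis using m by simp
      qed
      then show "m \<in> v \<rightarrow>\<^sub>E {..t}" using m by (auto simp: M_def PiE_def)
    qed
    then have "card {m \<in> M. sum m v \<le> t} \<le> card (v \<rightarrow>\<^sub>E {..t})"
      using u_eq by (intro card_mono finite_PiE) auto
    also have "\<dots> = (t + 1) ^ n" using u_eq by (simp add: card_PiE n_def)
    finally have "real (card {m \<in> M. sum m v \<le> t}) \<le> real ((t + 1) ^ n)"
      by (rule of_nat_mono)
    also have "\<dots> = (real t + 1) ^ n" by (simp add: add.commute)
    also have "\<dots> \<le> (2 * \<tau>) ^ n" using \<tau> by (intro power_mono) auto
    finally show "A * real (card {m \<in> M. sum m v \<le> t}) \<le> A * (2 * \<tau>) ^ n"
      using A by (rule mult_left_mono)
  next
    have b: "b > 0" using q by (simp add: b_def)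
    have "(\<Sum>m\<in>M. if Suc t \<le> sum m v then q ^ sum m v else 0)
        \<le> q ^ Suc t * b ^ n * real ((Suc t + n - 1) choose Suc t)"
      unfolding M_def b_def n_def by (rule sum_geometric_tail[OF u_eq(3) q])
    also have "\<dots> \<le> q ^ Suc t * b ^ n * (2 * \<tau>) ^ n"
      using choose_le_power[of t n] q b by (intro mult_left_mono) (auto simp: \<tau>_def)
    finally have "zeta a / 2 ^ t * (\<Sum>m\<in>M. if Suc t \<le> sum m v then q ^ sum m v else 0)
        \<le> zeta a / 2 ^ t * (q ^ Suc t * b ^ n * (2 * \<tau>) ^ n)"
      using zeta by (intro mult_left_mono) auto
    \<comment> \<open>The factor 2^(-t) is absorbed into the power of q because q / 2 = 2^(-a): then
      (q / 2)^(t + 1) = (2^(t + 1))^(-a) <= r^(-a).\<close>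
    also have "\<dots> = 2 * zeta a * (q / 2) ^ Suc t * b ^ n * (2 * \<tau>) ^ n"
    proof -
      have "x / p * (y * c * d) = 2 * x * (y / (2 * p)) * c * d" for x p y c d :: real
        by simp
      then show ?thesis by (simp only: power_divide power_Suc[of 2 t])
    qed
    also have "\<dots> \<le> 2 * zeta a * r powr (- a) * b ^ n * (2 * \<tau>) ^ n"
    proof -
      have "q / 2 = 2 powr (- a)" 
        using powr_diff[of 2 1 a] powr_minus_divide[of 2 a] by (simp add: q_def)
      then have "(q / 2) ^ Suc t = 2 powr (- a * real (Suc t))"
        by (simp only: powr_power) (simp add: mult.commute)
      also have "\<dots> = (2 powr real (Suc t)) powr (- a)"
        by (simp only: powr_powr mult.commute)
      also have "2 powr real (Suc t) = (2 :: real) ^ Suc t"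
        by (rule powr_realpow) simp
      also have "(2 ^ Suc t) powr (- a) \<le> r powr (- a)"
        using t(2) r_ge_1 a by (intro powr_mono2') auto
      finally show ?thesis
        using zeta b \<tau> by (intro mult_right_mono mult_left_mono) auto
    qed
    finally show "zeta a / 2 ^ t * (\<Sum>m\<in>M. if Suc t \<le> sum m v then q ^ sum m v else 0)
        \<le> 2 * zeta a * r powr (- a) * b ^ n * (2 * \<tau>) ^ n" .
  qed
  also have "\<dots> = r powr (- a) * (2 * \<tau>) ^ n * (1 + zeta a + 2 * zeta a * b ^ n)"
  proof -
    have "x * (1 + y) * c + 2 * y * x * d * c = x * c * (1 + y + 2 * y * d)" for x y c d :: real
      by (simp add: algebra_simps)
    then show ?thesis by (simp only: A_def)
  qed
  also have "\<dots> \<le> r powr (- a) * (2 * L) ^ n * (2 * (1 + zeta a) * b ^ Suc n)"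
  proof (intro mult_mono)
    have b: "zeta a \<le> b" using zeta_le_geometric[OF a] by (simp add: b_def q_def)
    have bn: "b ^ n \<ge> 1" using b zeta by (simp add: one_le_power)
    have "1 + zeta a + 2 * zeta a * b ^ n \<le> (1 + zeta a) * b ^ n + 2 * zeta a * b ^ n"
      using bn zeta by simp
    also have "\<dots> = (1 + 3 * zeta a) * b ^ n" by (simp add: algebra_simps)
    also have "\<dots> \<le> (2 * (1 + zeta a) * b) * b ^ n"
    proof (rule mult_right_mono)
      \<comment> \<open>This product is 2 (1 + zeta) zeta - (1 + 3 zeta); one factor zeta is then
        replaced by b, which completes the power b^(n + 1).\<close>
      have "0 \<le> (2 * zeta a + 1) * (zeta a - 1)"
        using zeta by simp
      then have "1 + 3 * zeta a \<le> 2 * (1 + zeta a) * zeta a"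
        by (simp add: algebra_simps)
      also have "\<dots> \<le> 2 * (1 + zeta a) * b"
        using b zeta by (intro mult_left_mono) auto
      finally show "1 + 3 * zeta a \<le> 2 * (1 + zeta a) * b" .
    qed (use bn in simp)
    finally show "1 + zeta a + 2 * zeta a * b ^ n \<le> 2 * (1 + zeta a) * b ^ Suc n"
      by (simp add: mult.assoc)
    show "0 \<le> 1 + zeta a + 2 * zeta a * b ^ n"
      using zeta bn by (auto intro!: add_nonneg_nonneg mult_nonneg_nonneg)
  qed (use \<tau> in \<open>auto intro: power_mono\<close>)
  finally have sum_W: "(\<Sum>m\<in>M. W m) \<le> r powr (- a) * (2 * L) ^ n * (2 * (1 + zeta a) * b ^ Suc n)" .
  have "(\<Sum>k\<in>F. ?w k) = (\<Sum>p\<in>dyadic_class v ` F. \<Sum>k\<in>{k \<in> F. dyadic_class v k = p}. ?w k)"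
    by (rule sum.image_gen) (rule F)
  also have "\<dots> \<le> (\<Sum>p\<in>dyadic_class v ` F. W (snd p))"
  proof (rule sum_mono)
    fix p assume "p \<in> dyadic_class v ` F"
    obtain \<sigma> m where p: "p = (\<sigma>, m)" by (cases p)
    let ?E = "{k \<in> F. dyadic_class v k = p}"
    have E: "finite ?E" "?E \<subseteq> {k \<in> D. dyadic_class v k = (\<sigma>, m)}"
      using F p by auto
    show "(\<Sum>k\<in>?E. ?w k) \<le> W (snd p)"
    proof (cases "sum m v \<le> t")
      case True
      then have "(2::real) ^ sum m v \<le> 2 ^ t" by simp
      then have "2 ^ sum m v \<le> r" using t(1) by linarith
      from sum_class_sparse[OF i v_def a E this] show ?thesis
        using True by (simp add: W_def p A_def)
    next
      case False
      then show ?thesis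
        using sum_class_dense[OF i v_def a E t(1)] by (simp add: W_def p q_def)
    qed
  qed
  also have "\<dots> \<le> (\<Sum>p\<in>S \<times> M. W (snd p))"
    using classes fin W by (intro sum_mono2) auto
  also have "\<dots> = 2 ^ Suc n * (\<Sum>m\<in>M. W m)"
    using card_S by (simp add: sum.cartesian_product')
  also have "\<dots> \<le> 2 ^ Suc n * (r powr (- a) * (2 * L) ^ n * (2 * (1 + zeta a) * b ^ Suc n))"
    using sum_W by (rule mult_left_mono) simp
  \<comment> \<open>The sign patterns give 2^(n + 1), the power of 2 L gives 2^n, and one factor 2
    remains: together 4^(n + 1).\<close>
  also have "\<dots> = r powr (- a) * (1 + zeta a) * (4 * b) ^ Suc n * L ^ n"
  proof -
    have "(4::real) ^ n = 2 ^ n * 2 ^ n" by (simp flip: power_mult_distrib)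
    then have "(4 * b) ^ Suc n = 4 * (2 ^ n * 2 ^ n) * b ^ Suc n"
      by (simp only: power_mult_distrib power_Suc[of 4])
    moreover have "2 * p * (x * (p * c) * (2 * y * d)) = x * y * (4 * (p * p) * d) * c"
      for x y p c d :: real by simp
    ultimately show ?thesis by (simp only: power_mult_distrib[of 2 L] power_Suc[of 2 n])
  qed
  also have "4 * b = 4 / (1 - 2 powr (1 - a))" by (simp add: b_def q_def)
  finally show ?thesis by (simp only: card_u diff_Suc_1)
qed

end

section \<open>Application to the dual lattice\<close>

lemma coord_sets_subset: "coord_sets s \<subseteq> fin_nonempty_sets"
  by (auto simp: coord_sets_def fin_nonempty_sets_def intro: finite_subset)

lemma finite_coord_sets: "finite (coord_sets s)"
  by (rule finite_subset[of _ "Pow {1..s}"]) (auto simp: coord_sets_def)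

lemma r_weight_le_rho:
  assumes u: "u \<in> coord_sets s" and N: "N \<ge> 1" and a: "\<alpha> > 0" and g: "\<gamma> u \<ge> 0"
    and k: "k \<in> dual_lattice N z u"
  shows "r_weight \<alpha> \<gamma> u k \<le> rho \<alpha> \<gamma> N s z"
proof -
  have fin: "finite u" using u coord_sets_subset by (auto simp: fin_nonempty_sets_def)
  \<comment> \<open>A real supremum dominates its family only if the family is bounded; attainment
    provides this.\<close>
  have "r_weight \<alpha> \<gamma> u k \<le> (SUP l\<in>dual_lattice N z u. r_weight \<alpha> \<gamma> u l)"
    using r_weight_Sup_attained[where \<gamma> = \<gamma> and u = u and z = z, OF fin N a g] k by auto
  also have "\<dots> \<le> rho \<alpha> \<gamma> N s z"
    unfolding rho_def using u finite_coord_sets by (intro Max_ge) auto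
  finally show ?thesis .
qed

text \<open>The difference of two points of the dual lattice, restricted to the coordinates where
  they differ, lies in the dual lattice of a smaller coordinate set. Monotonicity of the weights
  therefore gives the same lower bound for differences as for the points themselves.\<close>

lemma separated_vectors_dual_lattice:
  fixes \<gamma> :: "nat set \<Rightarrow> real"
  assumes N: "N \<ge> 1" and a: "\<alpha> > 0" and u: "u \<in> coord_sets s" and pos: "\<gamma> u > 0"
    and mono: "\<And>w. w \<subseteq> u \<Longrightarrow> w \<noteq> {} \<Longrightarrow> \<gamma> u \<le> \<gamma> w"
    and rho: "rho \<alpha> \<gamma> N s z > 0"
  defines "r \<equiv> max 1 ((\<gamma> u / rho \<alpha> \<gamma> N s z) powr (1 / (2 * \<alpha>)))"
  shows "separated_vectors u (dual_lattice N z u) r"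
proof
  have fin: "finite u" using u coord_sets_subset by (auto simp: fin_nonempty_sets_def)
  then show "finite u" .
  show "1 \<le> r" by (simp add: r_def)
  show "dual_lattice N z u \<subseteq> u \<rightarrow>\<^sub>E (UNIV - {0})" by (auto simp: dual_lattice_def)
  let ?\<rho> = "rho \<alpha> \<gamma> N s z"
  \<comment> \<open>Stated for every non-empty subset w, since a difference lives on the coordinates
    where it is non-zero. The inequality gamma_u p^(-2 alpha) <= gamma_w p^(-2 alpha) <= rho is
    solved for p.\<close>
  have ge: "r \<le> (\<Prod>j\<in>w. real_of_int \<bar>k j\<bar>)"
    if w: "w \<subseteq> u" "w \<noteq> {}" and k: "k \<in> dual_lattice N z w" for w k
  proof -
    define p where "p = (\<Prod>j\<in>w. real_of_int \<bar>k j\<bar>)"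
    have "real_of_int \<bar>k j\<bar> \<ge> 1" if "j \<in> w" for j
    proof -
      have "k j \<noteq> 0" using k that by (auto simp: dual_lattice_def PiE_def Pi_def)
      then show ?thesis by linarith
    qed
    then have p: "p \<ge> 1" unfolding p_def by (intro prod_ge_1) auto
    have ws: "w \<in> coord_sets s" using w u by (auto simp: coord_sets_def)
    have "r_weight \<alpha> \<gamma> w k \<le> ?\<rho>"
      using mono[OF w] pos by (intro r_weight_le_rho[OF ws N a _ k]) simp
    then have "\<gamma> w * p powr (- 2 * \<alpha>) \<le> ?\<rho>"
      by (simp add: r_weight_def p_def prod_powr_distrib)
    then have "\<gamma> u * p powr (- 2 * \<alpha>) \<le> ?\<rho>"
      using mult_right_mono[OF mono[OF w], of "p powr (- 2 * \<alpha>)"] by simp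
    then have "\<gamma> u / ?\<rho> \<le> p powr (2 * \<alpha>)"
      using p rho by (simp add: powr_minus field_simps)
    then have "(\<gamma> u / ?\<rho>) powr (1 / (2 * \<alpha>)) \<le> (p powr (2 * \<alpha>)) powr (1 / (2 * \<alpha>))"
      using pos rho a by (intro powr_mono2) auto
    then have "r \<le> p" using p a by (simp add: r_def powr_powr)
    then show ?thesis by (simp only: p_def)
  qed
  show "r \<le> (\<Prod>j\<in>u. real_of_int \<bar>k j\<bar>)" if "k \<in> dual_lattice N z u" for k
    using ge[OF order.refl _ that] u by (auto simp: coord_sets_def)
  show "r \<le> (\<Prod>j\<in>u. max 1 (real_of_int \<bar>k j - k' j\<bar>))"
    if k: "k \<in> dual_lattice N z u" and k': "k' \<in> dual_lattice N z u" and "k \<noteq> k'" for k k'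
  proof -
    define w where "w = {j \<in> u. k j \<noteq> k' j}"
    define d where "d = (\<lambda>j\<in>w. k j - k' j)"
    have "k \<in> extensional u" "k' \<in> extensional u"
      using k k' by (auto simp: dual_lattice_def PiE_def)
    then have "w \<noteq> {}"
      using \<open>k \<noteq> k'\<close> extensionalityI[of k u k'] by (auto simp: w_def)
    have "[(\<Sum>j\<in>u. k j * int (z j)) - (\<Sum>j\<in>u. k' j * int (z j)) = 0 - 0] (mod int N)"
      using k k' by (intro cong_diff) (auto simp: dual_lattice_def)
    moreover have "(\<Sum>j\<in>u. k j * int (z j)) - (\<Sum>j\<in>u. k' j * int (z j)) = (\<Sum>j\<in>w. d j * int (z j))"
    proof -
      have "(\<Sum>j\<in>w. d j * int (z j)) = (\<Sum>j\<in>w. (k j - k' j) * int (z j))"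
        by (intro sum.cong) (auto simp: d_def)
      also have "\<dots> = (\<Sum>j\<in>u. (k j - k' j) * int (z j))"
        using fin by (intro sum.mono_neutral_left) (auto simp: w_def)
      finally show ?thesis by (simp add: sum_subtractf left_diff_distrib)
    qed
    ultimately have "d \<in> dual_lattice N z w"
      by (auto simp: dual_lattice_def d_def w_def)
    then have "r \<le> (\<Prod>j\<in>w. real_of_int \<bar>d j\<bar>)"
      using \<open>w \<noteq> {}\<close> by (intro ge) (auto simp: w_def)
    also have "\<dots> = (\<Prod>j\<in>w. max 1 (real_of_int \<bar>k j - k' j\<bar>))"
    proof (rule prod.cong)
      fix j assume j: "j \<in> w"
      then have "\<bar>k j - k' j\<bar> \<ge> 1" by (auto simp: w_def)
      then have "real_of_int \<bar>k j - k' j\<bar> \<ge> 1" by linarith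
      then show "real_of_int \<bar>d j\<bar> = max 1 (real_of_int \<bar>k j - k' j\<bar>)"
        using j by (simp add: d_def max_def)
    qed simp
    \<comment> \<open>Where the vectors agree, the factor is \<open>max 1 0\<close>, that is
      1.\<close>
    also have "\<dots> = (\<Prod>j\<in>u. max 1 (real_of_int \<bar>k j - k' j\<bar>))"
      using fin by (intro prod.mono_neutral_left) (auto simp: w_def)
    finally show ?thesis .
  qed
qed

text \<open>Uses \<open>finite_sum_le\<close> with r = \<open>max 1 x\<close> and a = 2 alpha'. The
  power x^(-a) is (rho / gamma_u)^(alpha' / alpha), and x <= N turns log_2 r into log_2 N.\<close>

lemma infsum_r_weight_le:
  fixes \<gamma> \<gamma>' :: "nat set \<Rightarrow> real" and \<alpha> \<alpha>' :: real
  assumes N: "N \<ge> 2" and a: "\<alpha> > 0" "\<alpha>' > 1 / 2" and u: "u \<in> coord_sets s"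
    and pos: "\<gamma> u > 0" and \<gamma>': "\<gamma>' u \<ge> 0"
    and mono: "\<And>w. w \<subseteq> u \<Longrightarrow> w \<noteq> {} \<Longrightarrow> \<gamma> u \<le> \<gamma> w"
  shows "(\<Sum>\<^sub>\<infinity>k\<in>dual_lattice N z u. ennreal (r_weight \<alpha>' \<gamma>' u k))
    \<le> ennreal (c_const \<alpha>' * rho \<alpha> \<gamma> N s z powr (\<alpha>' / \<alpha>) * (\<gamma>' u / \<gamma> u powr (\<alpha>' / \<alpha>)
        * (2 powr (2 * \<alpha>' + 1) / (2 powr (2 * \<alpha>' - 1) - 1)) ^ card u
        * log 2 (real N) ^ (card u - 1)))"
proof -
  define a' where "a' = 2 * \<alpha>'"
  have a': "a' > 1" using a by (simp add: a'_def)
  define \<rho> where "\<rho> = rho \<alpha> \<gamma> N s z"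
  define x where "x = (\<gamma> u / \<rho>) powr (1 / (2 * \<alpha>))"
  define L where "L = log 2 (real N)"
  define C where "C = 2 powr (2 * \<alpha>' + 1) / (2 powr (2 * \<alpha>' - 1) - 1)"
  have N1: "N \<ge> 1" using N by simp
  obtain i where i: "i \<in> u" using u by (auto simp: coord_sets_def)
  have "\<gamma> u \<le> \<gamma> {i}" using mono[of "{i}"] i by simp
  \<comment> \<open>This point bounds rho below by gamma_u N^(-2 alpha), which gives both rho > 0
    and x <= N.\<close>
  have "(\<lambda>j\<in>{i}. int N) \<in> dual_lattice N z {i}"
    using N by (auto simp: dual_lattice_def cong_0_iff)
  moreover have "{i} \<in> coord_sets s" using i u by (auto simp: coord_sets_def)
  ultimately have "r_weight \<alpha> \<gamma> {i} (\<lambda>j\<in>{i}. int N) \<le> \<rho>"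
    unfolding \<rho>_def using \<open>\<gamma> u \<le> \<gamma> {i}\<close> pos by (intro r_weight_le_rho N1 a) auto
  then have "\<gamma> {i} * real N powr (- 2 * \<alpha>) \<le> \<rho>" by (simp add: r_weight_def)
  then have \<rho>_ge: "\<gamma> u * real N powr (- 2 * \<alpha>) \<le> \<rho>"
    using mult_right_mono[OF \<open>\<gamma> u \<le> \<gamma> {i}\<close>, of "real N powr (- 2 * \<alpha>)"] by simp
  moreover have "\<gamma> u * real N powr (- 2 * \<alpha>) > 0" using pos N by simp
  ultimately have \<rho>: "\<rho> > 0" by linarith
  have "\<gamma> u / \<rho> \<le> real N powr (2 * \<alpha>)"
    using \<rho>_ge \<rho> N by (simp add: powr_minus field_simps)
  then have "x \<le> (real N powr (2 * \<alpha>)) powr (1 / (2 * \<alpha>))"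
    unfolding x_def using pos \<rho> a by (intro powr_mono2) auto
  then have x: "0 < x" "x \<le> real N"
    using N a pos \<rho> by (simp_all add: powr_powr x_def)
  \<comment> \<open>N >= 2 is what makes log_2 N at least 1.\<close>
  have L: "1 \<le> L" "log 2 (max 1 x) \<le> L"
    using N x by (auto simp: L_def le_log_iff max_def)
  have C: "C = 4 / (1 - 2 powr (1 - a'))" "C > 0"
  proof -
    have "2 powr 0 < 2 powr (a' - 1)" using a' by (subst powr_less_cancel_iff) auto
    then have B: "2 powr (a' - 1) > 1" by simp
    have "4 / (1 - 1 / y) = 4 * y / (y - 1)" if "y > 1" for y :: real
      using that by (simp add: divide_simps)
    moreover have "2 powr (1 - a') = 1 / 2 powr (a' - 1)"
      using powr_minus_divide[of 2 "a' - 1"] by simp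
    ultimately have "4 / (1 - 2 powr (1 - a')) = 4 * 2 powr (a' - 1) / (2 powr (a' - 1) - 1)"
      using B by (simp only:)
    moreover have "2 powr (a' + 1) = 4 * 2 powr (a' - 1)"
      using powr_add[of 2 2 "a' - 1"] by (simp add: add.commute)
    moreover have "C = 2 powr (a' + 1) / (2 powr (a' - 1) - 1)"
      by (simp only: C_def a'_def)
    ultimately show "C = 4 / (1 - 2 powr (1 - a'))" "C > 0"
      using B by simp_all
  qed
  \<comment> \<open>The second summand of \<open>c_const\<close> is non-negative.\<close>
  have c: "1 + zeta a' \<le> c_const \<alpha>'"
    using a' zeta_ge_1[OF a'] by (simp add: c_const_def a'_def ge_one_powr_ge_zero)
  have x_powr: "x powr (- a') = \<rho> powr (\<alpha>' / \<alpha>) / \<gamma> u powr (\<alpha>' / \<alpha>)"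
  proof -
    have "x powr (- a') = (\<gamma> u / \<rho>) powr (- (\<alpha>' / \<alpha>))"
      using a by (simp add: x_def powr_powr a'_def)
    also have "\<dots> = (\<rho> / \<gamma> u) powr (\<alpha>' / \<alpha>)"
      using pos \<rho> by (simp add: powr_minus powr_divide)
    finally show ?thesis using pos \<rho> by (simp add: powr_divide)
  qed
  interpret separated_vectors u "dual_lattice N z u" "max 1 x"
    unfolding x_def \<rho>_def
    using N1 a(1) u pos mono \<rho> by (intro separated_vectors_dual_lattice) (auto simp: \<rho>_def)
  have finite_bound: "(\<Sum>k\<in>F. r_weight \<alpha>' \<gamma>' u k)
      \<le> c_const \<alpha>' * \<rho> powr (\<alpha>' / \<alpha>) * (\<gamma>' u / \<gamma> u powr (\<alpha>' / \<alpha>) * C ^ card u * L ^ (card u - 1))"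
    if F: "finite F" "F \<subseteq> dual_lattice N z u" for F
  proof -
    have "(\<Sum>k\<in>F. r_weight \<alpha>' \<gamma>' u k) = \<gamma>' u * (\<Sum>k\<in>F. \<Prod>j\<in>u. real_of_int \<bar>k j\<bar> powr (- a'))"
      by (simp add: r_weight_def sum_distrib_left a'_def)
    also have "\<dots> \<le> \<gamma>' u * (x powr (- a') * c_const \<alpha>' * C ^ card u * L ^ (card u - 1))"
      using \<gamma>'
    proof (rule mult_left_mono[rotated])
      have "(\<Sum>k\<in>F. \<Prod>j\<in>u. real_of_int \<bar>k j\<bar> powr (- a'))
        \<le> max 1 x powr (- a') * (1 + zeta a') * C ^ card u * L ^ (card u - 1)"
        unfolding C(1) using i L by (intro finite_sum_le[OF a' F]) auto
      also have "\<dots> \<le> x powr (- a') * c_const \<alpha>' * C ^ card u * L ^ (card u - 1)"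
        using c x a' L C zeta_ge_1[OF a']
        by (intro mult_right_mono mult_mono powr_mono2') auto
      finally show "(\<Sum>k\<in>F. \<Prod>j\<in>u. real_of_int \<bar>k j\<bar> powr (- a'))
          \<le> x powr (- a') * c_const \<alpha>' * C ^ card u * L ^ (card u - 1)" .
    qed
    finally show ?thesis
      by (simp add: x_powr mult_ac)
  qed
  have "(\<Sum>\<^sub>\<infinity>k\<in>dual_lattice N z u. ennreal (r_weight \<alpha>' \<gamma>' u k))
      \<le> ennreal (c_const \<alpha>' * \<rho> powr (\<alpha>' / \<alpha>) * (\<gamma>' u / \<gamma> u powr (\<alpha>' / \<alpha>) * C ^ card u * L ^ (card u - 1)))"
  proof (rule infsum_le_finite_sums)
    show "(\<lambda>k. ennreal (r_weight \<alpha>' \<gamma>' u k)) summable_on dual_lattice N z u"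
      by (rule nonneg_summable_on_complete) simp
    fix F assume "finite F" "F \<subseteq> dual_lattice N z u"
    have "r_weight \<alpha>' \<gamma>' u k \<ge> 0" for k
      using \<gamma>' by (simp add: r_weight_def prod_nonneg)
    then have "(\<Sum>k\<in>F. ennreal (r_weight \<alpha>' \<gamma>' u k)) = ennreal (\<Sum>k\<in>F. r_weight \<alpha>' \<gamma>' u k)"
      by (intro sum_ennreal) auto
    then show "(\<Sum>k\<in>F. ennreal (r_weight \<alpha>' \<gamma>' u k))
        \<le> ennreal (c_const \<alpha>' * \<rho> powr (\<alpha>' / \<alpha>) * (\<gamma>' u / \<gamma> u powr (\<alpha>' / \<alpha>) * C ^ card u * L ^ (card u - 1)))"
      using finite_bound[OF \<open>finite F\<close> \<open>F \<subseteq> dual_lattice N z u\<close>] by (simp add: ennreal_leI)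
  qed
  then show ?thesis by (simp only: \<rho>_def C_def L_def)
qed

theorem theorem1:
  fixes s N :: nat and z :: "nat \<Rightarrow> nat"
    and \<alpha> \<alpha>' :: real and \<gamma> \<gamma>' :: "nat set \<Rightarrow> real"
  assumes "s \<ge> 1" and "N \<ge> 1"
    and "\<And>j. j \<in> {1..s} \<Longrightarrow> z j \<in> {1..N - 1}"
    and "\<alpha> > 1 / 2" and "\<alpha>' > 1 / 2"
    and "\<And>u. u \<in> fin_nonempty_sets \<Longrightarrow> \<gamma> u \<ge> 0"
    and "\<And>u. u \<in> fin_nonempty_sets \<Longrightarrow> \<gamma>' u \<ge> 0"
    and "\<And>u v. u \<in> fin_nonempty_sets \<Longrightarrow> v \<in> fin_nonempty_sets \<Longrightarrow> v \<subset> u \<Longrightarrow> \<gamma> v \<ge> \<gamma> u"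
  shows "P_err \<alpha>' \<gamma>' N s z \<le>
    (if \<exists>u\<in>coord_sets s. \<gamma> u = 0 \<and> 0 < \<gamma>' u then \<infinity>
     else ennreal (c_const \<alpha>' * rho \<alpha> \<gamma> N s z powr (\<alpha>' / \<alpha>) *
       (\<Sum>u\<in>coord_sets s.
          \<gamma>' u / \<gamma> u powr (\<alpha>' / \<alpha>)
          * (2 powr (2 * \<alpha>' + 1) / (2 powr (2 * \<alpha>' - 1) - 1)) ^ card u
          * log 2 (real N) ^ (card u - 1))))"
proof (cases "\<exists>u\<in>coord_sets s. \<gamma> u = 0 \<and> 0 < \<gamma>' u")
  case False
  define A where "A = c_const \<alpha>' * rho \<alpha> \<gamma> N s z powr (\<alpha>' / \<alpha>)"
  define T where "T = (\<lambda>u. \<gamma>' u / \<gamma> u powr (\<alpha>' / \<alpha>)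
          * (2 powr (2 * \<alpha>' + 1) / (2 powr (2 * \<alpha>' - 1) - 1)) ^ card u
          * log 2 (real N) ^ (card u - 1))"
  \<comment> \<open>As s >= 1, the range {1..N - 1} contains z_1 and is not empty.\<close>
  have N: "N \<ge> 2" using assms(1) assms(3)[of 1] by auto
  have two: "(2::real) powr (2 * \<alpha>' - 1) \<ge> 1"
    using assms(5) by (simp add: ge_one_powr_ge_zero)
  have A: "A \<ge> 0"
    using two zeta_ge_1[of "2 * \<alpha>'"] assms(5) by (simp add: A_def c_const_def)
  have nonneg: "0 \<le> \<gamma> u" "0 \<le> \<gamma>' u" if "u \<in> coord_sets s" for u
    using assms(6,7) that coord_sets_subset by blast+
  have T: "T u \<ge> 0" if "u \<in> coord_sets s" for u
    using nonneg[OF that] two N by (simp add: T_def)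
  have summand: "(\<Sum>\<^sub>\<infinity>k\<in>dual_lattice N z u. ennreal (r_weight \<alpha>' \<gamma>' u k)) \<le> ennreal (A * T u)"
    if u: "u \<in> coord_sets s" for u
  proof (cases "\<gamma> u = 0")
    \<comment> \<open>Outside the infinite case gamma_u = 0 forces gamma'_u = 0, so the inner sum
      vanishes, in agreement with 0/0 = 0.\<close>
    case True
    then have "\<gamma>' u = 0" using False u nonneg[OF u] by force
    then show ?thesis by (simp add: r_weight_def)
  next
    case g: False
    have mono: "\<gamma> u \<le> \<gamma> w" if w: "w \<subseteq> u" "w \<noteq> {}" for w
    \<comment> \<open>Monotonicity is assumed for proper subsets only.\<close>
    proof (cases "w = u")
      case neq: False
      have "w \<in> coord_sets s" using u w by (auto simp: coord_sets_def)
      then show ?thesis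
        using assms(8)[of u w] u w neq coord_sets_subset by blast
    qed simp
    show ?thesis
      unfolding A_def T_def
      using N assms(4,5) u g nonneg[OF u] mono by (intro infsum_r_weight_le) auto
  qed
  have "P_err \<alpha>' \<gamma>' N s z \<le> (\<Sum>u\<in>coord_sets s. ennreal (A * T u))"
    unfolding P_err_def by (rule sum_mono) (rule summand)
  also have "\<dots> = ennreal (A * (\<Sum>u\<in>coord_sets s. T u))"
    unfolding sum_distrib_left using A T by (intro sum_ennreal) simp
  finally show ?thesis
    using False by (simp only: A_def T_def if_False)
qed auto

end
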